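(* Let $n\ge 2$, let $\mathcal{G}(\Pi_n)=(\mathcal{G}^0,\mathcal{G}^1)$ be the directed graph associated with the coordinate ring $\mathbb{K}[M_q(n)]$ of the $n\times n$ quantum matrix algebra, with $|\mathcal{G}^1|=\frac{(n^3+n^2)(n-1)}{2}$ edges, and let $\mathcal{H}=\ell^2(\mathbb{N})$. For each edge $i\in\mathcal{G}^1$, let $e_{hk}$ be the vertex from which $i$ exits (its source), let $\deg^{+}(e_{hk})$ be the number of edges exiting $e_{hk}$, and put $\mathcal{E}_i=\deg^{+}(e_{hk})\,(n^2-1)$. Then one can choose, for each edge $i\in\mathcal{G}^1$, integers $D_i\in\{0,\dots,n^2-2\}$ and $A_i\in\{0,\dots,\deg^{+}(e_{hk})\,(n^2-1)\}$ such that the operators $$S_i:=\sum_{j=1}^{\infty}E_{\mathcal{E}_i j-A_i,\ (n^2-1)j-D_i}\in B(\mathcal{H}),\qquad i\in\mathcal{G}^1,$$ form a Cuntz-Krieger $\mathcal{G}(\Pi_n)$-family, and hence give a graph $C^*$-algebra structure $\mathcal{C}^*(\Pi_n)$ (the $C^*$-subalgebra of $B(\mathcal{H})$ generated by the family).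
   Context: The graph $\mathcal{G}(\Pi_n)$ (with adjacency matrix $\Pi_n$) has vertex set $\mathcal{G}^0=\{e_{ab}:1\le a,b\le n\}$ (one vertex for each generator of $\mathbb{K}[M_q(n)]$) and the following directed edges, with no loops or multiple edges: (1) $e_{ab}\to e_{ac}$ whenever $b<c$ (same row); (2) $e_{ab}\to e_{cb}$ whenever $a<c$ (same column); (3) both $e_{ab}\to e_{cd}$ and $e_{cd}\to e_{ab}$ whenever $a<c$ and $b>d$. There are no other edges. In total there are $\frac{(n^3+n^2)(n-1)}{2}$ edges; $e_{11}$ is the only source and $e_{nn}$ the only sink. For an edge $e$, $s(e)$ denotes its source vertex and $r(e)$ its range vertex. $E_{k,l}$ ($k,l\ge 1$) denotes the matrix unit on $\ell^2(\mathbb{N})$ with respect to the standard orthonormal basis $(\xi_m)_{m\ge 1}$: $E_{k,l}\xi_m=\delta_{l,m}\xi_k$; infinite sums are taken in the strong operator topology (the indices appearing are required to be positive integers). A Cuntz-Krieger $\mathcal{G}(\Pi_n)$-family consists of partial isometries $S_e\in B(\mathcal{H})$, $e\in\mathcal{G}^1$, together with projections $P_v\in B(\mathcal{H})$, $v\in\mathcal{G}^0$, satisfying the relations $S_e^*S_e=P_{r(e)}$ for every edge $e\in\mathcal{G}^1$, and $P_v=\sum_{s(e)=v}S_eS_e^*$ for every vertex $v\in\mathcal{G}^0$ that is not a sink. *)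

theory Defs
  imports "HOL-Analysis.Analysis" "Graph_Theory.Digraph"
begin

section \<open>The Hilbert space of square-summable complex sequences\<close>

typedef ell2 = "{x :: nat \<Rightarrow> complex. summable (\<lambda>k. (cmod (x k))\<^sup>2)}"
  morphisms coord Abs_ell2
  by (rule exI[of _ "\<lambda>_. 0"]) simp

setup_lifting type_definition_ell2

lemma summable_coord: "summable (\<lambda>k. (cmod (coord x k))\<^sup>2)"
  using coord[of x] by simp

lemma ell2_eqI: "(\<And>k. coord x k = coord y k) \<Longrightarrow> x = y"
  by (metis coord_inject ext)

lemma cmod_add_sq: "(cmod (a + b))\<^sup>2 \<le> 2 * (cmod a)\<^sup>2 + 2 * (cmod b)\<^sup>2"
proof -
  have "(cmod (a + b))\<^sup>2 \<le> (cmod a + cmod b)\<^sup>2"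
    by (intro power_mono norm_triangle_ineq) auto
  also have "\<dots> \<le> 2 * (cmod a)\<^sup>2 + 2 * (cmod b)\<^sup>2"
    using sum_squares_bound[of "cmod a" "cmod b"] by (simp add: power2_sum)
  finally show ?thesis .
qed

lemma summable_sq_add:
  assumes "summable (\<lambda>k. (cmod (x k))\<^sup>2)" "summable (\<lambda>k. (cmod (y k))\<^sup>2)"
  shows "summable (\<lambda>k::nat. (cmod (x k + y k))\<^sup>2)"
proof (rule summable_comparison_test')
  show "summable (\<lambda>k. 2 * (cmod (x k))\<^sup>2 + 2 * (cmod (y k))\<^sup>2)"
    using assms by (intro summable_add summable_mult)
  show "norm ((cmod (x k + y k))\<^sup>2) \<le> 2 * (cmod (x k))\<^sup>2 + 2 * (cmod (y k))\<^sup>2" for k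
    using cmod_add_sq[of "x k" "y k"] by simp
qed

lemma summable_sq_scale:
  assumes "summable (\<lambda>k. (cmod (x k))\<^sup>2)"
  shows "summable (\<lambda>k::nat. (cmod (c * x k))\<^sup>2)"
  using summable_mult[OF assms, of "(cmod c)\<^sup>2"] by (simp add: norm_mult power_mult_distrib)

instantiation ell2 :: real_vector
begin

lift_definition zero_ell2 :: ell2 is "\<lambda>_. 0" by simp
lift_definition plus_ell2 :: "ell2 \<Rightarrow> ell2 \<Rightarrow> ell2" is "\<lambda>x y k. x k + y k"
  by (simp add: summable_sq_add)
lift_definition uminus_ell2 :: "ell2 \<Rightarrow> ell2" is "\<lambda>x k. - x k" by simp
definition minus_ell2 :: "ell2 \<Rightarrow> ell2 \<Rightarrow> ell2" where "minus_ell2 x y = x + - y"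
lift_definition scaleR_ell2 :: "real \<Rightarrow> ell2 \<Rightarrow> ell2" is "\<lambda>r x k. of_real r * x k"
  by (rule summable_sq_scale)

lemma coord_vector_simps [simp]:
  "coord 0 k = 0" "coord (x + y) k = coord x k + coord y k" "coord (- x) k = - coord x k"
  "coord (x - y) k = coord x k - coord y k" "coord (r *\<^sub>R x) k = of_real r * coord x k"
  by (simp_all add: minus_ell2_def zero_ell2.rep_eq plus_ell2.rep_eq uminus_ell2.rep_eq
      scaleR_ell2.rep_eq)

instance
  by standard (rule ell2_eqI, simp add: algebra_simps)+

end

lift_definition scaleC :: "complex \<Rightarrow> ell2 \<Rightarrow> ell2" (infixr "*\<^sub>C" 75) is "\<lambda>c x k. c * x k"
  by (rule summable_sq_scale)

lemma coord_scaleC [simp]: "coord (c *\<^sub>C x) k = c * coord x k"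
  by (simp add: scaleC.rep_eq)

definition cinner :: "ell2 \<Rightarrow> ell2 \<Rightarrow> complex" where
  "cinner x y = (\<Sum>k. coord x k * cnj (coord y k))"

lemma summable_cinner: "summable (\<lambda>k. coord x k * cnj (coord y k))"
proof (rule summable_comparison_test')
  show "summable (\<lambda>k. (cmod (coord x k))\<^sup>2 + (cmod (coord y k))\<^sup>2)"
    by (intro summable_add summable_coord)
  show "norm (coord x k * cnj (coord y k)) \<le> (cmod (coord x k))\<^sup>2 + (cmod (coord y k))\<^sup>2" for k
    using sum_squares_bound[of "cmod (coord x k)" "cmod (coord y k)"]
      mult_nonneg_nonneg[OF norm_ge_zero[of "coord x k"] norm_ge_zero[of "coord y k"]]
    unfolding norm_mult complex_mod_cnj by linarith
qed

lemma cinner_self: "cinner x x = of_real (\<Sum>k. (cmod (coord x k))\<^sup>2)"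
  unfolding cinner_def complex_norm_square[symmetric]
  using suminf_of_real[OF summable_coord[of x], where 'a = complex] by simp

lemma cinner_add_left: "cinner (x + y) z = cinner x z + cinner y z"
  unfolding cinner_def by (simp add: distrib_right suminf_add summable_cinner)

lemma cinner_scaleC_left: "cinner (c *\<^sub>C x) y = c * cinner x y"
  unfolding cinner_def using suminf_mult[OF summable_cinner[of x y], of c]
  by (simp add: mult.assoc)

lemma cinner_commute: "cinner y x = cnj (cinner x y)"
  unfolding cinner_def
  using bounded_linear.suminf[OF bounded_linear_cnj summable_cinner[of x y]]
  by (simp add: mult.commute)

lemma scaleR_scaleC: "r *\<^sub>R x = of_real r *\<^sub>C x"
  by (rule ell2_eqI) simp

instantiation ell2 :: real_inner
begin

definition inner_ell2 :: "ell2 \<Rightarrow> ell2 \<Rightarrow> real" where "inner_ell2 x y = Re (cinner x y)"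
definition norm_ell2 :: "ell2 \<Rightarrow> real" where "norm_ell2 x = sqrt (\<Sum>k. (cmod (coord x k))\<^sup>2)"
definition sgn_ell2 :: "ell2 \<Rightarrow> ell2" where "sgn_ell2 x = x /\<^sub>R norm x"
definition dist_ell2 :: "ell2 \<Rightarrow> ell2 \<Rightarrow> real" where "dist_ell2 x y = norm (x - y)"
definition uniformity_ell2 :: "(ell2 \<times> ell2) filter" where
  "uniformity_ell2 = (INF e\<in>{0<..}. principal {(x, y). dist x y < e})"
definition open_ell2 :: "ell2 set \<Rightarrow> bool" where
  "open_ell2 U \<longleftrightarrow> (\<forall>x\<in>U. eventually (\<lambda>(x', y). x' = x \<longrightarrow> y \<in> U) uniformity)"

instance
proof
  fix x y z :: ell2 and r :: real and U :: "ell2 set"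
  show "dist x y = norm (x - y)" by (rule dist_ell2_def)
  show "sgn x = x /\<^sub>R norm x" by (rule sgn_ell2_def)
  show "uniformity = (INF e\<in>{0<..}. principal {(x :: ell2, y). dist x y < e})"
    by (rule uniformity_ell2_def)
  show "open U \<longleftrightarrow> (\<forall>x\<in>U. eventually (\<lambda>(x', y). x' = x \<longrightarrow> y \<in> U) uniformity)"
    by (rule open_ell2_def)
  show "inner x y = inner y x"
    using cinner_commute[of x y] by (simp add: inner_ell2_def)
  show "inner (x + y) z = inner x z + inner y z"
    by (simp add: inner_ell2_def cinner_add_left)
  show "inner (r *\<^sub>R x) y = r * inner x y"
    by (simp add: inner_ell2_def scaleR_scaleC cinner_scaleC_left)
  show "0 \<le> inner x x"
    by (simp add: inner_ell2_def cinner_self suminf_nonneg summable_coord)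
  show "inner x x = 0 \<longleftrightarrow> x = 0"
  proof
    assume "inner x x = 0"
    then have "\<forall>k. (cmod (coord x k))\<^sup>2 = 0"
      using suminf_eq_zero_iff[OF summable_coord[of x]]
      by (simp add: inner_ell2_def cinner_self)
    then show "x = 0" by (intro ell2_eqI) simp
  qed (simp add: inner_ell2_def cinner_def)
  show "norm x = sqrt (inner x x)"
    by (simp add: norm_ell2_def inner_ell2_def cinner_self)
qed

end

lemma cmod_coord_le_norm: "cmod (coord x k) \<le> norm x"
proof -
  have "(cmod (coord x k))\<^sup>2 \<le> (\<Sum>j. (cmod (coord x j))\<^sup>2)"
    using sum_le_suminf[OF summable_coord[of x], of "{k}"] by simp
  then show ?thesis unfolding norm_ell2_def by (rule real_le_rsqrt)
qed

lemma norm_scaleC: "norm (c *\<^sub>C x) = cmod c * norm x"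
proof -
  have "(\<Sum>k. (cmod (c * coord x k))\<^sup>2) = (cmod c)\<^sup>2 * (\<Sum>k. (cmod (coord x k))\<^sup>2)"
    using suminf_mult[OF summable_coord[of x], of "(cmod c)\<^sup>2"]
    by (simp add: norm_mult power_mult_distrib)
  then show ?thesis by (simp add: norm_ell2_def real_sqrt_mult)
qed

lemma sum_coord_le_norm: "(\<Sum>k<N. (cmod (coord x k))\<^sup>2) \<le> (norm x)\<^sup>2"
proof -
  have "(norm x)\<^sup>2 = (\<Sum>k. (cmod (coord x k))\<^sup>2)"
    unfolding norm_ell2_def by (simp add: suminf_nonneg summable_coord)
  then show ?thesis using sum_le_suminf[OF summable_coord[of x], of "{..<N}"] by simp
qed

instance ell2 :: banach
proof
  fix X :: "nat \<Rightarrow> ell2"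
  assume "Cauchy X"
  have "Cauchy (\<lambda>m. coord (X m) k)" for k
  proof (rule CauchyI)
    fix e :: real assume "e > 0"
    then obtain M where M: "\<forall>m\<ge>M. \<forall>n\<ge>M. norm (X m - X n) < e"
      using CauchyD[OF \<open>Cauchy X\<close>] by blast
    have "norm (coord (X m) k - coord (X n) k) < e" if "m \<ge> M" "n \<ge> M" for m n
      using cmod_coord_le_norm[of "X m - X n" k] M that by (simp add: le_less_trans)
    then show "\<exists>M. \<forall>m\<ge>M. \<forall>n\<ge>M. norm (coord (X m) k - coord (X n) k) < e" by blast
  qed
  then have "\<forall>k. \<exists>l. (\<lambda>m. coord (X m) k) \<longlonglongrightarrow> l"
    by (meson Cauchy_convergent convergent_def)
  then obtain L where L: "\<And>k. (\<lambda>m. coord (X m) k) \<longlonglongrightarrow> L k" by metis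
  have tail: "\<exists>M. \<forall>n\<ge>M. \<forall>N. (\<Sum>k<N. (cmod (L k - coord (X n) k))\<^sup>2) \<le> e\<^sup>2" if e0: "e > 0" for e :: real
  proof -
    obtain M where M: "\<forall>m\<ge>M. \<forall>n\<ge>M. norm (X m - X n) < e"
      using CauchyD[OF \<open>Cauchy X\<close> e0] by blast
    have "(\<Sum>k<N. (cmod (L k - coord (X n) k))\<^sup>2) \<le> e\<^sup>2" if "n \<ge> M" for n N
    proof (rule LIMSEQ_le_const2)
      show "(\<lambda>m. \<Sum>k<N. (cmod (coord (X m) k - coord (X n) k))\<^sup>2)
              \<longlonglongrightarrow> (\<Sum>k<N. (cmod (L k - coord (X n) k))\<^sup>2)"
        by (intro tendsto_intros L)
      have "(\<Sum>k<N. (cmod (coord (X m) k - coord (X n) k))\<^sup>2) \<le> e\<^sup>2" if "m \<ge> M" for m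
      proof -
        have "(\<Sum>k<N. (cmod (coord (X m) k - coord (X n) k))\<^sup>2) \<le> (norm (X m - X n))\<^sup>2"
          using sum_coord_le_norm[of "X m - X n" N] by simp
        also have "\<dots> \<le> e\<^sup>2"
          using M that \<open>n \<ge> M\<close> by (intro power_mono) (auto simp: less_imp_le)
        finally show ?thesis .
      qed
      then show "\<exists>M. \<forall>m\<ge>M. (\<Sum>k<N. (cmod (coord (X m) k - coord (X n) k))\<^sup>2) \<le> e\<^sup>2"
        by blast
    qed
    then show ?thesis by blast
  qed
  have sq: "summable (\<lambda>k. (cmod (L k))\<^sup>2)"
  proof -
    obtain M where M: "\<And>N. (\<Sum>k<N. (cmod (L k - coord (X M) k))\<^sup>2) \<le> 1"
      using tail[OF zero_less_one] by (metis order_refl one_power2)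
    have "summable (\<lambda>k. (cmod (L k - coord (X M) k))\<^sup>2)"
      by (rule summableI_nonneg_bounded[where x = 1]) (auto simp: M)
    from summable_sq_add[OF this summable_coord[of "X M"]] show ?thesis by simp
  qed
  define y where "y = Abs_ell2 L"
  have y: "coord y k = L k" for k
    unfolding y_def using sq by (simp add: Abs_ell2_inverse)
  have "X \<longlonglongrightarrow> y"
  proof (rule LIMSEQ_I)
    fix r :: real assume "r > 0"
    then obtain M where M: "\<And>n N. n \<ge> M \<Longrightarrow> (\<Sum>k<N. (cmod (L k - coord (X n) k))\<^sup>2) \<le> (r / 2)\<^sup>2"
      using tail[of "r / 2"] half_gt_zero by blast
    have "norm (X n - y) < r" if "n \<ge> M" for n
    proof -
      have "(\<Sum>k. (cmod (coord (y - X n) k))\<^sup>2) \<le> (r / 2)\<^sup>2"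
        by (rule suminf_le_const[OF summable_coord]) (simp add: y M that)
      then have "norm (y - X n) \<le> r / 2"
        unfolding norm_ell2_def using \<open>r > 0\<close> by (intro real_le_lsqrt) (auto simp: suminf_nonneg summable_coord)
      then show ?thesis using \<open>r > 0\<close> by (simp add: norm_minus_commute)
    qed
    then show "\<exists>M. \<forall>n\<ge>M. norm (X n - y) < r" by blast
  qed
  then show "convergent X" by (auto simp: convergent_def)
qed

text \<open>
  The standard orthonormal basis is indexed from 1, whereas coordinates are indexed from 0.
  The value at 0 is junk.
\<close>

lift_definition \<xi> :: "nat \<Rightarrow> ell2" is "\<lambda>m k. if k = m - 1 then 1 else 0"
proof -
  show "summable (\<lambda>k. (cmod (if k = m - 1 then 1 else 0))\<^sup>2)" for m :: nat
    by (rule summable_finite[of "{m - 1}"]) auto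
qed

lemma coord_\<xi>: "coord (\<xi> m) k = (if k = m - 1 then 1 else 0)"
  by (simp add: \<xi>.rep_eq)

lemma cinner_\<xi>_right: "cinner x (\<xi> m) = coord x (m - 1)"
proof -
  have "cinner x (\<xi> m) = (\<Sum>k\<in>{m - 1}. coord x k * cnj (coord (\<xi> m) k))"
    unfolding cinner_def by (rule suminf_finite) (auto simp: coord_\<xi>)
  then show ?thesis by (simp add: coord_\<xi>)
qed

lemma orthonormal_\<xi>:
  assumes "l \<ge> 1" "m \<ge> 1"
  shows "cinner (\<xi> l) (\<xi> m) = (if l = m then 1 else 0)"
  using assms by (auto simp: cinner_\<xi>_right coord_\<xi>)

section \<open>Bounded operators\<close>

text \<open>
  \<^typ>\<open>ell2 \<Rightarrow>\<^sub>L ell2\<close> consists of the bounded real-linear maps, with the operator norm;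
  \<open>bounded_ops\<close> is $B(\mathcal{H})$.
\<close>

definition bounded_ops :: "(ell2 \<Rightarrow>\<^sub>L ell2) set" where
  "bounded_ops = {T. \<forall>c x. blinfun_apply T (c *\<^sub>C x) = c *\<^sub>C blinfun_apply T x}"

lemma bounded_linear_scaleC: "bounded_linear (\<lambda>x. c *\<^sub>C x)"
  by (rule bounded_linear_intro[where K = "cmod c"])
    (auto intro: ell2_eqI simp: algebra_simps norm_scaleC)

definition scale_op :: "complex \<Rightarrow> (ell2 \<Rightarrow>\<^sub>L ell2) \<Rightarrow> (ell2 \<Rightarrow>\<^sub>L ell2)" where
  "scale_op c T = Blinfun (\<lambda>x. c *\<^sub>C blinfun_apply T x)"

lemma scale_op_apply: "blinfun_apply (scale_op c T) x = c *\<^sub>C blinfun_apply T x"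
  unfolding scale_op_def
  by (subst bounded_linear_Blinfun_apply)
    (auto intro: bounded_linear_compose[OF bounded_linear_scaleC] blinfun.bounded_linear_right)

definition adj :: "(ell2 \<Rightarrow>\<^sub>L ell2) \<Rightarrow> (ell2 \<Rightarrow>\<^sub>L ell2)" where
  "adj T = (THE U. \<forall>x y. cinner (blinfun_apply U x) y = cinner x (blinfun_apply T y))"

definition is_projection :: "(ell2 \<Rightarrow>\<^sub>L ell2) \<Rightarrow> bool" where
  "is_projection P \<longleftrightarrow> P \<in> bounded_ops \<and> P o\<^sub>L P = P \<and> adj P = P"

text \<open>A partial isometry is isometric on the orthogonal complement of its kernel.\<close>

definition partial_isometry :: "(ell2 \<Rightarrow>\<^sub>L ell2) \<Rightarrow> bool" where
  "partial_isometry T \<longleftrightarrow> T \<in> bounded_ops \<and>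
     (\<forall>x. (\<forall>y. blinfun_apply T y = 0 \<longrightarrow> cinner x y = 0)
            \<longrightarrow> norm (blinfun_apply T x) = norm x)"

lift_definition matrix_unit :: "nat \<Rightarrow> nat \<Rightarrow> (ell2 \<Rightarrow>\<^sub>L ell2)"
  is "\<lambda>k l x. cinner x (\<xi> l) *\<^sub>C \<xi> k"
proof -
  fix k l
  show "bounded_linear (\<lambda>x. cinner x (\<xi> l) *\<^sub>C \<xi> k)"
    by (rule bounded_linear_intro[where K = "norm (\<xi> k)"])
      (auto intro: ell2_eqI intro!: mult_right_mono cmod_coord_le_norm
        simp: distrib_right norm_scaleC cinner_\<xi>_right)
qed

lemma matrix_unit_\<xi>:
  assumes "l \<ge> 1" "m \<ge> 1"
  shows "blinfun_apply (matrix_unit k l) (\<xi> m) = (if l = m then \<xi> k else 0)"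
  using assms by (auto simp: matrix_unit.rep_eq orthonormal_\<xi> intro!: ell2_eqI)

text \<open>Convergence of a series of operators in the strong operator topology.\<close>

definition sot_sums :: "(nat \<Rightarrow> (ell2 \<Rightarrow>\<^sub>L ell2)) \<Rightarrow> (ell2 \<Rightarrow>\<^sub>L ell2) \<Rightarrow> bool" where
  "sot_sums F T \<longleftrightarrow> (\<forall>x. (\<lambda>j. blinfun_apply (F j) x) sums blinfun_apply T x)"

definition cstar_subalgebra :: "(ell2 \<Rightarrow>\<^sub>L ell2) set \<Rightarrow> bool" where
  "cstar_subalgebra \<A> \<longleftrightarrow> \<A> \<subseteq> bounded_ops \<and> 0 \<in> \<A> \<and>
     (\<forall>T\<in>\<A>. \<forall>U\<in>\<A>. T + U \<in> \<A>) \<and> (\<forall>c. \<forall>T\<in>\<A>. scale_op c T \<in> \<A>) \<and>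
     (\<forall>T\<in>\<A>. \<forall>U\<in>\<A>. T o\<^sub>L U \<in> \<A>) \<and> (\<forall>T\<in>\<A>. adj T \<in> \<A>) \<and> closed \<A>"

definition cstar_generated :: "(ell2 \<Rightarrow>\<^sub>L ell2) set \<Rightarrow> (ell2 \<Rightarrow>\<^sub>L ell2) set" where
  "cstar_generated X = \<Inter> {\<A>. cstar_subalgebra \<A> \<and> X \<subseteq> \<A>}"

section \<open>Cuntz--Krieger families\<close>

text \<open>
  For graphs with finitely many arcs. The vertex projections are not required to be mutually
  orthogonal.
\<close>

definition cuntz_krieger_family ::
    "('v, 'e) pre_digraph \<Rightarrow> ('e \<Rightarrow> (ell2 \<Rightarrow>\<^sub>L ell2)) \<Rightarrow> ('v \<Rightarrow> (ell2 \<Rightarrow>\<^sub>L ell2)) \<Rightarrow> bool" where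
  "cuntz_krieger_family G S P \<longleftrightarrow>
     (\<forall>e\<in>arcs G. partial_isometry (S e)) \<and>
     (\<forall>v\<in>verts G. is_projection (P v)) \<and>
     (\<forall>e\<in>arcs G. adj (S e) o\<^sub>L S e = P (head G e)) \<and>
     (\<forall>v\<in>verts G. out_arcs G v \<noteq> {} \<longrightarrow> P v = (\<Sum>e\<in>out_arcs G v. S e o\<^sub>L adj (S e)))"

definition graph_cstar_algebra ::
    "('v, 'e) pre_digraph \<Rightarrow> ('e \<Rightarrow> (ell2 \<Rightarrow>\<^sub>L ell2)) \<Rightarrow> ('v \<Rightarrow> (ell2 \<Rightarrow>\<^sub>L ell2))
       \<Rightarrow> (ell2 \<Rightarrow>\<^sub>L ell2) set" where
  "graph_cstar_algebra G S P = cstar_generated (S ` arcs G \<union> P ` verts G)"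

section \<open>The graph of the quantum matrix algebra\<close>

text \<open>The vertex $e_{ab}$ is the pair \<open>(a, b)\<close>; an arc is the pair of its source and its range.\<close>

definition Pi_arcs :: "nat \<Rightarrow> ((nat \<times> nat) \<times> (nat \<times> nat)) set" where
  "Pi_arcs n =
     {((a, b), (a, c)) | a b c. a \<in> {1..n} \<and> b \<in> {1..n} \<and> c \<in> {1..n} \<and> b < c} \<union>
     {((a, b), (c, b)) | a b c. a \<in> {1..n} \<and> b \<in> {1..n} \<and> c \<in> {1..n} \<and> a < c} \<union>
     {((a, b), (c, d)) | a b c d.
        a \<in> {1..n} \<and> b \<in> {1..n} \<and> c \<in> {1..n} \<and> d \<in> {1..n} \<and> a < c \<and> b > d} \<union>
     {((c, d), (a, b)) | a b c d.
        a \<in> {1..n} \<and> b \<in> {1..n} \<and> c \<in> {1..n} \<and> d \<in> {1..n} \<and> a < c \<and> b > d}"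

definition Pi_graph :: "nat \<Rightarrow> (nat \<times> nat, (nat \<times> nat) \<times> (nat \<times> nat)) pre_digraph" where
  "Pi_graph n = \<lparr>verts = {1..n} \<times> {1..n}, arcs = Pi_arcs n, tail = fst, head = snd\<rparr>"

definition \<E> :: "nat \<Rightarrow> (nat \<times> nat) \<times> (nat \<times> nat) \<Rightarrow> nat" where
  "\<E> n i = out_degree (Pi_graph n) (tail (Pi_graph n) i) * (n\<^sup>2 - 1)"

end

theory Submission
  imports Defs
begin

text \<open>
  The initial and final projections of operators of the required shape are projections onto the
  closed span of the basis vectors in an arithmetic progression. Put $N = n^2 - 1$. The initial
  projection of $S_i$ belongs to the residue class of $-D_i$ modulo $N$, its final projection to
  the residue class of $-A_i$ modulo $d N$, where $d$ is the out-degree of the source of $i$. The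
  relation $S_i^* S_i = P_{r(i)}$ thus says that $D_i$ depends on the range of $i$ only, say $D_i
  = \delta_{r(i)}$, and the relation for $P_v$ says that the class of $-\delta_v$ modulo $N$ is
  the disjoint union of the classes of $-A_i$ modulo $d N$ over the $d$ edges $i$ that leave $v$.
  But a class modulo $N$ splits into exactly $d$ classes modulo $d N$, so it suffices to hand them
  out to the $d$ edges by any bijection.

  There are $N$ classes modulo $N$ and $N + 1$ vertices. The vertices are numbered row by row, and
  $e_{11}$, the only vertex at which no edge ends, shares the class of $e_{12}$; the projections
  of the other vertices are mutually orthogonal.

  On the operator side, a strictly increasing map $p$ of the index set gives an isometry $V_p$
  (\<open>basis_embed p\<close>) with adjoint $V_p^*$ (\<open>basis_compress p\<close>). All
  operators are of the form $V_p V_q^*$, and all relations follow from $V_p^* V_p = 1$ and the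
  description of $V_p V_p^*$ as the projection onto the coordinates in the range of $p$
  (\<open>coord_embed_compress\<close>). Finally, the generated $C^*$-algebra is a
  $C^*$-subalgebra as soon as some $C^*$-subalgebra contains the generators; the adjointable
  operators form one (\<open>cstar_subalgebra_adjointable\<close>).
\<close>

section \<open>Adjoints\<close>

definition is_adjoint :: "(ell2 \<Rightarrow>\<^sub>L ell2) \<Rightarrow> (ell2 \<Rightarrow>\<^sub>L ell2) \<Rightarrow> bool" where
  "is_adjoint T U \<longleftrightarrow> (\<forall>x y. cinner (blinfun_apply U x) y = cinner x (blinfun_apply T y))"

lemma cinner_add_right: "cinner x (y + z) = cinner x y + cinner x z"
  by (metis cinner_add_left cinner_commute complex_cnj_add)

lemma cinner_scaleC_right: "cinner x (c *\<^sub>C y) = cnj c * cinner x y"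
  by (metis cinner_scaleC_left cinner_commute complex_cnj_mult)

lemma cinner_diff_left: "cinner (x - y) z = cinner x z - cinner y z"
  by (metis add_diff_cancel_right' cinner_add_left diff_add_cancel)

lemma cinner_diff_right: "cinner x (y - z) = cinner x y - cinner x z"
  by (metis add_diff_cancel_right' cinner_add_right diff_add_cancel)

lemma cinner_self_eq_norm: "cinner x x = of_real ((norm x)\<^sup>2)"
  by (simp add: cinner_self norm_ell2_def suminf_nonneg summable_coord)

lemma cinner_self_eq_0_iff: "cinner x x = 0 \<longleftrightarrow> x = 0"
  by (simp add: cinner_self_eq_norm)

lemma cinner_ext:
  assumes "\<And>y. cinner x y = cinner x' y"
  shows "x = x'"
proof -
  have "cinner (x - x') (x - x') = 0"
    using assms by (simp add: cinner_diff_left)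
  then show ?thesis by (simp add: cinner_self_eq_0_iff)
qed

text \<open>
  This reduces the continuity of the complex inner product to that of the real one, which the
  class \<^class>\<open>real_inner\<close> provides.
\<close>

lemma cinner_eq_Complex_inner: "cinner x y = Complex (inner x y) (inner x (\<i> *\<^sub>C y))"
  by (simp add: complex_eq_iff inner_ell2_def cinner_scaleC_right)

lemma tendsto_cinner_left:
  assumes "(f \<longlongrightarrow> x) F"
  shows "((\<lambda>m. cinner (f m) y) \<longlongrightarrow> cinner x y) F"
  unfolding cinner_eq_Complex_inner by (intro tendsto_Complex tendsto_inner assms tendsto_const)

lemma tendsto_cinner_right:
  assumes "(f \<longlongrightarrow> x) F"
  shows "((\<lambda>m. cinner y (f m)) \<longlongrightarrow> cinner y x) F"
  by (subst (1 2) cinner_commute) (intro tendsto_cnj tendsto_cinner_left assms)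

lemma is_adjoint_sym: "is_adjoint T U \<Longrightarrow> is_adjoint U T"
  unfolding is_adjoint_def by (metis cinner_commute)

lemma adj_eq: "is_adjoint T U \<Longrightarrow> adj T = U"
  unfolding adj_def is_adjoint_def
  by (rule the_equality) (auto intro!: blinfun_eqI cinner_ext)

lemma is_adjoint_compose:
  "is_adjoint T U \<Longrightarrow> is_adjoint T' U' \<Longrightarrow> is_adjoint (T o\<^sub>L T') (U' o\<^sub>L U)"
  by (simp add: is_adjoint_def)

lemma is_adjoint_add:
  "is_adjoint T U \<Longrightarrow> is_adjoint T' U' \<Longrightarrow> is_adjoint (T + T') (U + U')"
  by (simp add: is_adjoint_def blinfun.add_left cinner_add_left cinner_add_right)

lemma is_adjoint_diff:
  "is_adjoint T U \<Longrightarrow> is_adjoint T' U' \<Longrightarrow> is_adjoint (T - T') (U - U')"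
  by (simp add: is_adjoint_def blinfun.diff_left cinner_diff_left cinner_diff_right)

lemma is_adjoint_scale: "is_adjoint T U \<Longrightarrow> is_adjoint (scale_op c T) (scale_op (cnj c) U)"
  by (simp add: is_adjoint_def scale_op_apply cinner_scaleC_left cinner_scaleC_right)

text \<open>The complex linearity of \<open>T\<close> is inherited from the inner product.\<close>

lemma is_adjoint_bounded_ops:
  assumes "is_adjoint T U"
  shows "T \<in> bounded_ops"
proof -
  have "cinner (blinfun_apply T x) y = cinner x (blinfun_apply U y)" for x y
    using is_adjoint_sym[OF assms] by (simp add: is_adjoint_def)
  then show ?thesis
    unfolding bounded_ops_def by (auto intro!: cinner_ext simp: cinner_scaleC_left)
qed

lemma norm_adjoint_le:
  assumes "is_adjoint T U"
  shows "norm U \<le> norm T"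
proof (rule norm_blinfun_bound)
  fix x
  let ?u = "blinfun_apply U x"
  have "(norm ?u)\<^sup>2 = inner x (blinfun_apply T ?u)"
    using assms by (simp add: power2_norm_eq_inner inner_ell2_def is_adjoint_def)
  also have "\<dots> \<le> norm x * norm (blinfun_apply T ?u)"
    by (rule norm_cauchy_schwarz)
  also have "\<dots> \<le> norm x * (norm T * norm ?u)"
    by (intro mult_left_mono norm_blinfun) simp
  finally have "norm ?u * norm ?u \<le> (norm T * norm x) * norm ?u"
    by (simp add: power2_eq_square mult_ac)
  then show "norm ?u \<le> norm T * norm x"
    by (cases "?u = 0") auto
qed simp

text \<open>
  Taking adjoints is isometric, so the adjoints of a convergent sequence converge as well; their
  limit is the adjoint of the limit.
\<close>

lemma closed_adjointable: "closed {T. \<exists>U. is_adjoint T U}"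
  unfolding closed_sequential_limits
proof (intro allI impI, elim conjE)
  fix f T assume "\<forall>m. f m \<in> {T. \<exists>U. is_adjoint T U}" and lim: "f \<longlonglongrightarrow> T"
  then obtain g where g: "\<And>m. is_adjoint (f m) (g m)" by simp metis
  have "Cauchy g"
  proof (rule CauchyI)
    fix e :: real assume "e > 0"
    then obtain M where M: "\<forall>m\<ge>M. \<forall>k\<ge>M. norm (f m - f k) < e"
      using CauchyD[OF LIMSEQ_imp_Cauchy[OF lim]] by blast
    have "norm (g m - g k) \<le> norm (f m - f k)" for m k
      by (intro norm_adjoint_le is_adjoint_diff g)
    then show "\<exists>M. \<forall>m\<ge>M. \<forall>k\<ge>M. norm (g m - g k) < e"
      using M by (meson le_less_trans)
  qed
  then obtain U where U: "g \<longlonglongrightarrow> U"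
    by (auto simp: Cauchy_convergent_iff convergent_def)
  have "cinner (blinfun_apply U x) y = cinner x (blinfun_apply T y)" for x y
  proof (rule LIMSEQ_unique)
    show "(\<lambda>m. cinner (blinfun_apply (g m) x) y) \<longlonglongrightarrow> cinner (blinfun_apply U x) y"
      by (intro tendsto_cinner_left blinfun.tendsto U tendsto_const)
    have "(\<lambda>m. cinner x (blinfun_apply (f m) y)) \<longlonglongrightarrow> cinner x (blinfun_apply T y)"
      by (intro tendsto_cinner_right blinfun.tendsto lim tendsto_const)
    then show "(\<lambda>m. cinner (blinfun_apply (g m) x) y) \<longlonglongrightarrow> cinner x (blinfun_apply T y)"
      using g by (simp add: is_adjoint_def)
  qed
  then show "T \<in> {T. \<exists>U. is_adjoint T U}" by (auto simp: is_adjoint_def)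
qed

lemma cstar_subalgebra_adjointable: "cstar_subalgebra {T. \<exists>U. is_adjoint T U}"
  unfolding cstar_subalgebra_def
proof (intro conjI)
  show "{T. \<exists>U. is_adjoint T U} \<subseteq> bounded_ops"
    by (auto intro: is_adjoint_bounded_ops)
  have "is_adjoint 0 0" by (simp add: is_adjoint_def cinner_def)
  then show "0 \<in> {T. \<exists>U. is_adjoint T U}" by blast
  show "\<forall>T\<in>{T. \<exists>U. is_adjoint T U}. adj T \<in> {T. \<exists>U. is_adjoint T U}"
    using adj_eq is_adjoint_sym by blast
qed (auto intro: is_adjoint_add is_adjoint_scale is_adjoint_compose closed_adjointable)

text \<open>
  An intersection of $C^*$-subalgebras is one provided that it is not the intersection of the
  empty family, which would be the set of all real-linear bounded maps.
\<close>

lemma cstar_subalgebra_generated: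
  assumes "\<And>T. T \<in> X \<Longrightarrow> \<exists>U. is_adjoint T U"
  shows "cstar_subalgebra (cstar_generated X)"
proof -
  have "{T. \<exists>U. is_adjoint T U} \<in> {\<A>. cstar_subalgebra \<A> \<and> X \<subseteq> \<A>}"
    using assms cstar_subalgebra_adjointable by auto
  then have "cstar_generated X \<subseteq> bounded_ops"
    unfolding cstar_generated_def by (auto intro: is_adjoint_bounded_ops)
  moreover have "closed (cstar_generated X)"
    unfolding cstar_generated_def by (rule closed_Inter) (auto simp: cstar_subalgebra_def)
  ultimately show ?thesis
    unfolding cstar_subalgebra_def by (auto simp: cstar_generated_def cstar_subalgebra_def)
qed

text \<open>
  A vector $x$ orthogonal to the kernel is fixed by $T^* T$: the difference $x - T^* T x$ lies in the
  kernel, hence is orthogonal to $x$, and it is orthogonal to $T^* T x$ as well.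
\<close>

lemma partial_isometryI:
  assumes adj: "is_adjoint T U" and TUT: "T o\<^sub>L U o\<^sub>L T = T"
  shows "partial_isometry T"
  unfolding partial_isometry_def
proof (intro conjI allI impI)
  show "T \<in> bounded_ops" by (rule is_adjoint_bounded_ops[OF adj])
  fix x assume orth: "\<forall>y. blinfun_apply T y = 0 \<longrightarrow> cinner x y = 0"
  define y where "y = x - blinfun_apply U (blinfun_apply T x)"
  have "blinfun_apply T (blinfun_apply U (blinfun_apply T x)) = blinfun_apply T x"
    using TUT by (metis blinfun_compose.rep_eq comp_apply)
  then have Ty: "blinfun_apply T y = 0"
    by (simp add: y_def blinfun.diff_right)
  have "cinner (blinfun_apply U (blinfun_apply T x)) y = cinner (blinfun_apply T x) 0"
    using adj by (simp add: is_adjoint_def Ty)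
  then have "cinner (blinfun_apply U (blinfun_apply T x)) y = 0"
    by (simp add: cinner_def)
  moreover have "cinner x y = 0" using orth Ty by blast
  ultimately have "cinner y y = 0"
    by (subst (1) y_def) (simp add: cinner_diff_left)
  then have fixed: "blinfun_apply U (blinfun_apply T x) = x"
    by (simp add: cinner_self_eq_0_iff y_def)
  have "cinner (blinfun_apply T x) (blinfun_apply T x) = cinner x x"
    using adj fixed unfolding is_adjoint_def by metis
  then have "(norm (blinfun_apply T x))\<^sup>2 = (norm x)\<^sup>2"
    by (simp only: cinner_self_eq_norm of_real_eq_iff)
  then show "norm (blinfun_apply T x) = norm x" by simp
qed

section \<open>Isometries induced by maps of the index set\<close>

text \<open>
  Coordinates are counted from 0 here, so that \<open>basis_embed p\<close> sends \<open>\<xi> (Suc j)\<close> to \<open>\<xi> (Suc (p j))\<close>. Both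
  operators are meant for strictly increasing \<open>p\<close>.
\<close>

definition basis_embed :: "(nat \<Rightarrow> nat) \<Rightarrow> (ell2 \<Rightarrow>\<^sub>L ell2)" where
  "basis_embed p = Blinfun (\<lambda>x. Abs_ell2 (\<lambda>k. if k \<in> range p then coord x (inv p k) else 0))"

definition basis_compress :: "(nat \<Rightarrow> nat) \<Rightarrow> (ell2 \<Rightarrow>\<^sub>L ell2)" where
  "basis_compress p = Blinfun (\<lambda>x. Abs_ell2 (\<lambda>j. coord x (p j)))"

lemma norm_sq_ell2: "(norm x)\<^sup>2 = (\<Sum>k. (cmod (coord x k))\<^sup>2)"
  by (simp add: norm_ell2_def suminf_nonneg summable_coord)

context
  fixes p :: "nat \<Rightarrow> nat"
  assumes p: "strict_mono p"
begin

lemma inv_strict_mono: "inv p (p j) = j"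
  using p by (simp add: strict_mono_imp_inj_on)

lemma coord_embed:
  "coord (blinfun_apply (basis_embed p) x) k = (if k \<in> range p then coord x (inv p k) else 0)"
proof -
  define c where "c = (\<lambda>x k. if k \<in> range p then coord x (inv p k) else 0)"
  have sq: "summable (\<lambda>k. (cmod (c x k))\<^sup>2)" "(\<Sum>k. (cmod (c x k))\<^sup>2) = (norm x)\<^sup>2" for x
  proof -
    have eq: "(\<lambda>j. (cmod (c x (p j)))\<^sup>2) = (\<lambda>j. (cmod (coord x j))\<^sup>2)"
      by (simp add: c_def inv_strict_mono)
    show "summable (\<lambda>k. (cmod (c x k))\<^sup>2)"
      by (subst summable_mono_reindex[OF p, symmetric]) (auto simp: c_def inv_strict_mono summable_coord)
    have "(\<Sum>j. (cmod (c x (p j)))\<^sup>2) = (\<Sum>k. (cmod (c x k))\<^sup>2)"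
      by (rule suminf_mono_reindex[OF p]) (auto simp: c_def)
    then show "(\<Sum>k. (cmod (c x k))\<^sup>2) = (norm x)\<^sup>2"
      unfolding eq by (simp add: norm_sq_ell2)
  qed
  have coord: "coord (Abs_ell2 (c x)) k = c x k" for x k
    using sq(1) by (simp add: Abs_ell2_inverse)
  have "bounded_linear (\<lambda>x. Abs_ell2 (c x))"
  proof (rule bounded_linear_intro[where K = 1])
    fix x
    have "(norm (Abs_ell2 (c x)))\<^sup>2 = (norm x)\<^sup>2"
      by (simp add: norm_sq_ell2[of "Abs_ell2 (c x)"] coord sq(2))
    then show "norm (Abs_ell2 (c x)) \<le> norm x * 1" by simp
  qed (auto intro!: ell2_eqI simp: coord, auto simp: c_def)
  then show ?thesis
    unfolding basis_embed_def using coord[of x k]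
    by (simp add: bounded_linear_Blinfun_apply c_def)
qed

lemma coord_compress: "coord (blinfun_apply (basis_compress p) x) j = coord x (p j)"
proof -
  have sq: "summable (\<lambda>j. (cmod (coord x (p j)))\<^sup>2)"
      "(\<Sum>j. (cmod (coord x (p j)))\<^sup>2) \<le> (norm x)\<^sup>2" for x
  proof -
    define f where "f = (\<lambda>k. if k \<in> range p then (cmod (coord x k))\<^sup>2 else 0)"
    have le: "f k \<le> (cmod (coord x k))\<^sup>2" "norm (f k) \<le> (cmod (coord x k))\<^sup>2" for k
      by (auto simp: f_def)
    have f: "summable f"
      by (rule summable_comparison_test'[OF summable_coord[of x]]) (rule le(2))
    have fp: "(\<lambda>j. f (p j)) = (\<lambda>j. (cmod (coord x (p j)))\<^sup>2)" by (simp add: f_def)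
    have zero: "f k = 0" if "k \<notin> range p" for k using that by (simp add: f_def)
    show "summable (\<lambda>j. (cmod (coord x (p j)))\<^sup>2)"
      using summable_mono_reindex[OF p, of f] f zero by (simp add: fp)
    have "(\<Sum>j. (cmod (coord x (p j)))\<^sup>2) = suminf f"
      using suminf_mono_reindex[OF p, of f] zero by (simp add: fp)
    also have "\<dots> \<le> (norm x)\<^sup>2"
      unfolding norm_sq_ell2 by (intro suminf_le le(1) f summable_coord)
    finally show "(\<Sum>j. (cmod (coord x (p j)))\<^sup>2) \<le> (norm x)\<^sup>2" .
  qed
  have coord: "coord (Abs_ell2 (\<lambda>j. coord x (p j))) j = coord x (p j)" for x j
    using sq(1) by (simp add: Abs_ell2_inverse)
  have "bounded_linear (\<lambda>x. Abs_ell2 (\<lambda>j. coord x (p j)))"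
  proof (rule bounded_linear_intro[where K = 1])
    fix x
    have "(norm (Abs_ell2 (\<lambda>j. coord x (p j))))\<^sup>2 \<le> (norm x)\<^sup>2"
      by (simp add: norm_sq_ell2[of "Abs_ell2 _"] coord sq(2))
    then show "norm (Abs_ell2 (\<lambda>j. coord x (p j))) \<le> norm x * 1"
      unfolding mult_1_right by (rule power2_le_imp_le) simp
  qed (rule ell2_eqI, simp only: coord, simp add: coord)+
  then show ?thesis
    unfolding basis_compress_def using coord[of x j] by (simp add: bounded_linear_Blinfun_apply)
qed

lemma is_adjoint_embed: "is_adjoint (basis_embed p) (basis_compress p)"
  unfolding is_adjoint_def
proof (intro allI)
  fix x y
  have "(\<Sum>j. coord x (p j) * cnj (coord (blinfun_apply (basis_embed p) y) (p j))) =
      (\<Sum>k. coord x k * cnj (coord (blinfun_apply (basis_embed p) y) k))"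
    by (rule suminf_mono_reindex[OF p]) (simp add: coord_embed)
  then show "cinner (blinfun_apply (basis_compress p) x) y = cinner x (blinfun_apply (basis_embed p) y)"
    by (simp add: cinner_def coord_compress coord_embed inv_strict_mono)
qed

lemma compress_embed: "blinfun_apply (basis_compress p) (blinfun_apply (basis_embed p) x) = x"
  by (rule ell2_eqI) (simp add: coord_compress coord_embed inv_strict_mono)

lemma coord_embed_compress:
  "coord (blinfun_apply (basis_embed p o\<^sub>L basis_compress p) x) k = (if k \<in> range p then coord x k else 0)"
  by (auto simp: coord_embed coord_compress inv_strict_mono)

lemma is_projection_embed_compress: "is_projection (basis_embed p o\<^sub>L basis_compress p)"
proof -
  have "is_adjoint (basis_embed p o\<^sub>L basis_compress p) (basis_embed p o\<^sub>L basis_compress p)"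
    by (intro is_adjoint_compose is_adjoint_embed is_adjoint_sym[OF is_adjoint_embed])
  then show ?thesis
    unfolding is_projection_def
    by (auto intro: is_adjoint_bounded_ops adj_eq) (auto intro!: blinfun_eqI simp: compress_embed)
qed

lemma embed_\<xi>: "blinfun_apply (basis_embed p) (c *\<^sub>C \<xi> (Suc j)) = c *\<^sub>C \<xi> (Suc (p j))"
  by (rule ell2_eqI) (auto simp: coord_embed coord_\<xi> inv_strict_mono)

end

text \<open>The squared norms of the remainders are the tails of a convergent series.\<close>

lemma \<xi>_expansion: "(\<lambda>j. coord x j *\<^sub>C \<xi> (Suc j)) sums x"
proof -
  define R where "R = (\<lambda>m. x - (\<Sum>j<m. coord x j *\<^sub>C \<xi> (Suc j)))"
  have coord_sum: "coord (\<Sum>j\<in>I. f j) k = (\<Sum>j\<in>I. coord (f j) k)" for f I k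
    by (induction I rule: infinite_finite_induct) auto
  have cR: "coord (R m) k = (if k < m then 0 else coord x k)" for m k
    by (auto simp: R_def coord_sum coord_\<xi> if_distrib[of "\<lambda>z. _ * z"] cong: if_cong)
  have "(norm (R m))\<^sup>2 = (norm x)\<^sup>2 - (\<Sum>k<m. (cmod (coord x k))\<^sup>2)" for m
  proof -
    have "(norm (R m))\<^sup>2 = (\<Sum>k. (cmod (coord (R m) (k + m)))\<^sup>2)"
      unfolding norm_sq_ell2 by (subst suminf_split_initial_segment[OF summable_coord, of _ m])
        (simp add: cR)
    also have "\<dots> = (\<Sum>k. (cmod (coord x (k + m)))\<^sup>2)" by (simp add: cR)
    also have "\<dots> = (norm x)\<^sup>2 - (\<Sum>k<m. (cmod (coord x k))\<^sup>2)"
      unfolding norm_sq_ell2 by (rule suminf_minus_initial_segment[OF summable_coord])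
    finally show ?thesis .
  qed
  moreover have "(\<lambda>m. \<Sum>k<m. (cmod (coord x k))\<^sup>2) \<longlonglongrightarrow> (norm x)\<^sup>2"
    unfolding norm_sq_ell2 by (rule summable_LIMSEQ[OF summable_coord])
  ultimately have "(\<lambda>m. (norm (R m))\<^sup>2) \<longlonglongrightarrow> 0"
    using tendsto_diff[OF tendsto_const, of _ "(norm x)\<^sup>2" _ "(norm x)\<^sup>2"] by simp
  then have "(\<lambda>m. sqrt ((norm (R m))\<^sup>2)) \<longlonglongrightarrow> sqrt 0"
    by (rule tendsto_real_sqrt)
  then have "R \<longlonglongrightarrow> 0" by (simp add: tendsto_norm_zero_iff)
  then have "(\<lambda>m. x - R m) \<longlonglongrightarrow> x - 0" by (intro tendsto_diff tendsto_const)
  then show ?thesis by (simp add: R_def sums_def)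
qed

text \<open>This identifies the partial isometry $V_p V_q^*$ with a sum of matrix units.\<close>

lemma sot_sums_embed_compress:
  assumes p: "strict_mono p" and q: "strict_mono q"
  shows "sot_sums (\<lambda>j. matrix_unit (Suc (p j)) (Suc (q j))) (basis_embed p o\<^sub>L basis_compress q)"
  unfolding sot_sums_def
proof
  fix x
  have "(\<lambda>j. blinfun_apply (basis_embed p) (coord (blinfun_apply (basis_compress q) x) j *\<^sub>C \<xi> (Suc j)))
      sums blinfun_apply (basis_embed p) (blinfun_apply (basis_compress q) x)"
    by (rule bounded_linear.sums[OF blinfun.bounded_linear_right \<xi>_expansion])
  then show "(\<lambda>j. blinfun_apply (matrix_unit (Suc (p j)) (Suc (q j))) x)
      sums blinfun_apply (basis_embed p o\<^sub>L basis_compress q) x"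
    by (simp add: embed_\<xi>[OF p] coord_compress[OF q] matrix_unit.rep_eq cinner_\<xi>_right)
qed

lemma is_adjoint_embed_compress:
  assumes "strict_mono p" "strict_mono q"
  shows "is_adjoint (basis_embed p o\<^sub>L basis_compress q) (basis_embed q o\<^sub>L basis_compress p)"
  by (intro is_adjoint_compose is_adjoint_embed is_adjoint_sym[OF is_adjoint_embed] assms)

lemma embed_compress_compose:
  assumes "strict_mono q"
  shows "(basis_embed p o\<^sub>L basis_compress q) o\<^sub>L (basis_embed q o\<^sub>L basis_compress r) = basis_embed p o\<^sub>L basis_compress r"
  by (rule blinfun_eqI) (simp add: compress_embed[OF assms])

lemma partial_isometry_embed_compress:
  assumes "strict_mono p" "strict_mono q"
  shows "partial_isometry (basis_embed p o\<^sub>L basis_compress q)"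
  by (rule partial_isometryI[OF is_adjoint_embed_compress[OF assms]])
    (simp only: embed_compress_compose assms)

text \<open>
  The progressions \<open>\<lambda>j. d * j + r\<close>, \<open>r < d\<close>, partition the natural numbers, so the corresponding
  isometries satisfy the Cuntz relation $\sum_r V_r V_r^* = 1$; this is its transport by the
  isometry \<open>basis_embed q\<close>.
\<close>

lemma embed_compress_split:
  assumes q: "strict_mono q" and d: "d > 0" and bij: "bij_betw \<kappa> X {..<d}"
  shows "basis_embed q o\<^sub>L basis_compress q =
    (\<Sum>e\<in>X. basis_embed (\<lambda>j. q (d * j + \<kappa> e)) o\<^sub>L basis_compress (\<lambda>j. q (d * j + \<kappa> e)))"
proof (rule blinfun_eqI, rule ell2_eqI)
  fix x k
  have fin: "finite X" using bij bij_betw_finite by blast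
  let ?p = "\<lambda>e j. q (d * j + \<kappa> e)"
  have p: "strict_mono (?p e)" for e
    using d by (intro strict_monoI strict_monoD[OF q]) simp
  have coord_sum: "coord (blinfun_apply (\<Sum>e\<in>Y. F e) x) k = (\<Sum>e\<in>Y. coord (blinfun_apply (F e) x) k)"
    for F :: "'a \<Rightarrow> ell2 \<Rightarrow>\<^sub>L ell2" and Y
    by (induction Y rule: infinite_finite_induct) (auto simp: blinfun.add_left)
  have "(\<Sum>e\<in>X. if k \<in> range (?p e) then coord x k else 0) = (if k \<in> range q then coord x k else 0)"
  proof (cases "k \<in> range q")
    case True
    then obtain m where k: "k = q m" by blast
    have "m mod d \<in> \<kappa> ` X" using bij d by (simp add: bij_betw_def)
    then obtain e where e: "e \<in> X" "\<kappa> e = m mod d" by force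
    have "k \<in> range (?p e') \<longleftrightarrow> e' = e" if "e' \<in> X" for e'
    proof
      assume "k \<in> range (?p e')"
      then obtain j where "q m = q (d * j + \<kappa> e')" using k by auto
      then have "m = d * j + \<kappa> e'" using strict_mono_eq[OF q] by blast
      moreover have "\<kappa> e' < d" using bij that by (auto simp: bij_betw_def)
      ultimately have "\<kappa> e' = \<kappa> e" using e by simp
      then show "e' = e" using bij that e(1) unfolding bij_betw_def by (blast dest: inj_onD)
    next
      assume "e' = e"
      then show "k \<in> range (?p e')"
        using e k by (intro range_eqI[where x = "m div d"]) simp
    qed
    then have "(\<Sum>e'\<in>X. if k \<in> range (?p e') then coord x k else 0) =
        (\<Sum>e'\<in>X. if e' = e then coord x k else 0)"
      by (intro sum.cong) auto
    then show ?thesis using True fin e by simp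
  qed (auto intro!: sum.neutral)
  then show "coord (blinfun_apply (basis_embed q o\<^sub>L basis_compress q) x) k =
      coord (blinfun_apply (\<Sum>e\<in>X. basis_embed (?p e) o\<^sub>L basis_compress (?p e)) x) k"
    unfolding coord_sum coord_embed_compress[OF p] coord_embed_compress[OF q] by simp
qed

section \<open>The graph of the quantum matrix algebra\<close>

lemma card_strict_pairs: "2 * card {(b, c). b \<in> {1..n} \<and> c \<in> {1..n} \<and> b < (c :: nat)} = n * (n - 1)"
proof -
  have "{(b, c). b \<in> {1..n} \<and> c \<in> {1..n} \<and> b < c} = prod.swap ` (SIGMA c:{1..n}. {1..<c})"
    by auto
  then have "card {(b, c). b \<in> {1..n} \<and> c \<in> {1..n} \<and> b < c} = (\<Sum>c\<in>{1..n}. c - 1)"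
    by (simp add: card_image)
  moreover have "2 * (\<Sum>c\<in>{1..n}. c - 1) = n * (n - 1)"
  proof (induction n)
    case (Suc n)
    then show ?case by (cases n) (auto simp: algebra_simps)
  qed simp
  ultimately show ?thesis by simp
qed

text \<open>
  With $m$ pairs $b < c$ in $\{1, \dots, n\}$, there are $n m$ arcs within rows, $n m$ arcs within
  columns and $m^2$ antidiagonal arcs in either direction.
\<close>

lemma card_Pi_arcs:
  assumes "n \<ge> 1"
  shows "finite (Pi_arcs n)"
    and "real (card (Pi_arcs n)) = (real n ^ 3 + real n ^ 2) * (real n - 1) / 2"
proof -
  define L where "L = {(b, c). b \<in> {1..n} \<and> c \<in> {1..n} \<and> b < (c :: nat)}"
  have "finite L"
    by (rule finite_subset[of _ "{1..n} \<times> {1..n}"]) (auto simp: L_def)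
  define R where "R = (\<lambda>(a, b, c). ((a, b), (a, c))) ` ({1..n} \<times> L)"
  define C where "C = (\<lambda>(b, a, c). ((a, b), (c, b))) ` ({1..n} \<times> L)"
  define X where "X = (\<lambda>((a, c), (d, b)). ((a, b), (c, d))) ` (L \<times> L)"
  define Y where "Y = (\<lambda>((a, c), (d, b)). ((c, d), (a, b))) ` (L \<times> L)"
  note defs = R_def C_def X_def Y_def
  have fin: "finite R" "finite C" "finite X" "finite Y"
    using \<open>finite L\<close> by (simp_all add: defs)
  have arcs: "Pi_arcs n = ((R \<union> C) \<union> X) \<union> Y"
    unfolding Pi_arcs_def defs L_def by (auto simp: image_iff)
  show "finite (Pi_arcs n)" using fin by (simp add: arcs)
  have card: "card R = n * card L" "card C = n * card L"
      "card X = card L * card L" "card Y = card L * card L"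
    unfolding defs
    by (subst card_image; force simp: inj_on_def card_cartesian_product)+
  have disj: "R \<inter> C = {}" "(R \<union> C) \<inter> X = {}" "(R \<union> C \<union> X) \<inter> Y = {}"
    unfolding defs L_def by auto
  have "card (Pi_arcs n) = 2 * (n * card L) + 2 * (card L * card L)"
    unfolding arcs by (simp add: card_Un_disjoint fin disj card)
  then have total: "real (card (Pi_arcs n)) =
      2 * (real n * real (card L)) + 2 * (real (card L) * real (card L))"
    by simp
  have card_L: "real (card L) = real n * (real n - 1) / 2"
  proof -
    have "real (2 * card L) = real (n * (n - 1))"
      unfolding L_def by (simp only: card_strict_pairs)
    then show ?thesis using assms by (simp add: of_nat_diff)
  qed
  show "real (card (Pi_arcs n)) = (real n ^ 3 + real n ^ 2) * (real n - 1) / 2"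
    unfolding total card_L by (simp add: field_simps power2_eq_square power3_eq_cube)
qed

section \<open>The Cuntz--Krieger family\<close>

text \<open>The position \<open>M * Suc j - C\<close> of a basis vector, turned into a coordinate counted from 0.\<close>

definition slot :: "nat \<Rightarrow> nat \<Rightarrow> nat \<Rightarrow> nat" where
  "slot M C j = M * Suc j - C - 1"

lemma Suc_slot: "C < M \<Longrightarrow> Suc (slot M C j) = M * Suc j - C"
  by (simp add: slot_def)

lemma strict_mono_slot:
  assumes "C < M"
  shows "strict_mono (slot M C)"
proof (rule strict_monoI_Suc)
  fix j
  have "M * Suc (Suc j) = M * Suc j + M" "M * Suc j \<ge> M" by simp_all
  then show "slot M C j < slot M C (Suc j)"
    using assms unfolding slot_def by linarith
qed

text \<open>
  The class of $-C$ modulo \<open>N\<close> splits into \<open>d\<close> classes modulo \<open>d * N\<close>. The offset \<open>C\<close> is subtracted, so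
  the class with the largest offset contributes the first element.
\<close>

lemma slot_mult:
  assumes "C < N" "r < d"
  shows "slot (d * N) (C + N * (d - 1 - r)) j = slot N C (d * j + r)"
proof -
  obtain s where s: "d = Suc (r + s)" using assms(2) less_iff_Suc_add by auto
  have "d * N * Suc j = N * Suc (d * j + r) + N * s"
    by (simp add: s algebra_simps)
  moreover have "d - 1 - r = s" using s by simp
  ultimately show ?thesis by (simp add: slot_def)
qed

text \<open>
  Numbering the vertices row by row from $-1$. Truncated subtraction merges the values at $e_{11}$
  and $e_{12}$, so that the remaining range has exactly $n^2 - 1$ elements.
\<close>

definition vertex_offset :: "nat \<Rightarrow> nat \<times> nat \<Rightarrow> nat" where
  "vertex_offset n = (\<lambda>(a, b). (a - 1) * n + (b - 1) - 1)"

lemma vertex_offset_le: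
  assumes "v \<in> {1..n} \<times> {1..n}"
  shows "vertex_offset n v \<le> n\<^sup>2 - 2"
proof -
  obtain a b where v: "v = (a, b)" "a \<le> n" "1 \<le> b" "b \<le> n" "1 \<le> a" using assms by auto
  have "(a - 1) * n \<le> (n - 1) * n" using v by (intro mult_right_mono) auto
  also have "\<dots> = n\<^sup>2 - n" by (simp add: power2_eq_square diff_mult_distrib)
  finally have "(a - 1) * n + (b - 1) \<le> (n\<^sup>2 - n) + (n - 1)" using v by linarith
  moreover have "n \<le> n\<^sup>2" by (simp add: power2_eq_square)
  ultimately show ?thesis using v unfolding vertex_offset_def by simp
qed

theorem theorem4p21:
  fixes n :: nat
  assumes "n \<ge> 2"
  shows "real (card (arcs (Pi_graph n))) = (real n ^ 3 + real n ^ 2) * (real n - 1) / 2 \<and>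
    (\<exists>(D :: (nat \<times> nat) \<times> (nat \<times> nat) \<Rightarrow> nat) (A :: (nat \<times> nat) \<times> (nat \<times> nat) \<Rightarrow> nat)
        (S :: (nat \<times> nat) \<times> (nat \<times> nat) \<Rightarrow> (ell2 \<Rightarrow>\<^sub>L ell2)) (P :: nat \<times> nat \<Rightarrow> (ell2 \<Rightarrow>\<^sub>L ell2)).
       (\<forall>i\<in>arcs (Pi_graph n).
          D i \<in> {0..n\<^sup>2 - 2} \<and> A i \<in> {0..\<E> n i} \<and>
          (\<forall>j\<ge>1. A i < \<E> n i * j \<and> D i < (n\<^sup>2 - 1) * j) \<and>
          sot_sums (\<lambda>j. matrix_unit (\<E> n i * Suc j - A i) ((n\<^sup>2 - 1) * Suc j - D i)) (S i)) \<and>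
       cuntz_krieger_family (Pi_graph n) S P \<and>
       cstar_subalgebra (graph_cstar_algebra (Pi_graph n) S P))"
proof -
  let ?G = "Pi_graph n"
  define N where "N = n\<^sup>2 - 1"
  define d where "d = out_degree ?G"
  define \<delta> where "\<delta> = vertex_offset n"
  have "n\<^sup>2 \<ge> 2\<^sup>2" using assms by (intro power_mono) auto
  then have \<delta>: "\<delta> v \<le> n\<^sup>2 - 2" "\<delta> v < N" if "v \<in> verts ?G" for v
    using vertex_offset_le[of v n] that by (auto simp: \<delta>_def N_def Pi_graph_def)
  have fin: "finite (out_arcs ?G v)" for v
    using assms card_Pi_arcs(1)[of n] by (simp add: out_arcs_def Pi_graph_def)
  then have "\<forall>v. \<exists>h. bij_betw h (out_arcs ?G v) {..<d v}"
    using ex_bij_betw_finite_nat by (auto simp: d_def out_degree_def atLeast0LessThan)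
  then obtain \<kappa> where \<kappa>: "\<And>v. bij_betw (\<kappa> v) (out_arcs ?G v) {..<d v}" by metis
  have ends: "fst i \<in> verts ?G" "snd i \<in> verts ?G" "\<kappa> (fst i) i < d (fst i)"
    if "i \<in> arcs ?G" for i
  proof -
    show "fst i \<in> verts ?G" "snd i \<in> verts ?G"
      using that by (auto simp: Pi_graph_def Pi_arcs_def)
    have "i \<in> out_arcs ?G (fst i)" using that by (simp add: Pi_graph_def)
    then show "\<kappa> (fst i) i < d (fst i)" using \<kappa>[of "fst i"] by (auto simp: bij_betw_def)
  qed

  define A where "A = (\<lambda>i. \<delta> (fst i) + N * (d (fst i) - 1 - \<kappa> (fst i) i))"
  define q where "q = (\<lambda>v. slot N (\<delta> v))"
  define p where "p = (\<lambda>i. slot (d (fst i) * N) (A i))"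
  define S where "S = (\<lambda>i. basis_embed (p i) o\<^sub>L basis_compress (q (snd i)))"
  define P where "P = (\<lambda>v. basis_embed (q v) o\<^sub>L basis_compress (q v))"

  have \<E>: "\<E> n i = d (fst i) * N" for i
    by (simp add: \<E>_def d_def N_def Pi_graph_def)
  have A: "A i < d (fst i) * N" if "i \<in> arcs ?G" for i
  proof -
    have "A i < N + N * (d (fst i) - 1 - \<kappa> (fst i) i)"
      using \<delta>(2)[OF ends(1)[OF that]] by (simp add: A_def)
    also have "\<dots> = N * Suc (d (fst i) - 1 - \<kappa> (fst i) i)" by simp
    also have "\<dots> \<le> N * d (fst i)"
      using ends(3)[OF that] by (intro mult_left_mono) auto
    finally show ?thesis by (simp add: mult.commute)
  qed
  have q: "strict_mono (q v)" if "v \<in> verts ?G" for v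
    unfolding q_def by (intro strict_mono_slot \<delta> that)
  have p: "strict_mono (p i)" if "i \<in> arcs ?G" for i
    unfolding p_def by (intro strict_mono_slot A that)
  have p_eq: "p i = (\<lambda>j. q (fst i) (d (fst i) * j + \<kappa> (fst i) i))" if "i \<in> arcs ?G" for i
    unfolding p_def q_def A_def using ends[OF that] \<delta>(2) by (intro ext slot_mult) auto
  have adjS: "is_adjoint (S i) (basis_embed (q (snd i)) o\<^sub>L basis_compress (p i))" if "i \<in> arcs ?G" for i
    unfolding S_def by (intro is_adjoint_embed_compress p q ends that)

  have params: "\<delta> (snd i) \<in> {0..n\<^sup>2 - 2} \<and> A i \<in> {0..\<E> n i} \<and>
      (\<forall>j\<ge>1. A i < \<E> n i * j \<and> \<delta> (snd i) < (n\<^sup>2 - 1) * j) \<and>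
      sot_sums (\<lambda>j. matrix_unit (\<E> n i * Suc j - A i) ((n\<^sup>2 - 1) * Suc j - \<delta> (snd i))) (S i)"
    if i: "i \<in> arcs ?G" for i
  proof (intro conjI allI impI)
    show "\<delta> (snd i) \<in> {0..n\<^sup>2 - 2}" using \<delta>(1) ends(2)[OF i] by simp
    show "A i \<in> {0..\<E> n i}" using A[OF i] by (simp add: \<E>)
    show "A i < \<E> n i * j" if "1 \<le> j" for j
      unfolding \<E> using A[OF i] mult_le_mono2[OF that, of "d (fst i) * N"] by linarith
    show "\<delta> (snd i) < (n\<^sup>2 - 1) * j" if "1 \<le> j" for j
      unfolding N_def[symmetric] using \<delta>(2)[OF ends(2)[OF i]] mult_le_mono2[OF that, of N]
      by linarith
    show "sot_sums (\<lambda>j. matrix_unit (\<E> n i * Suc j - A i) ((n\<^sup>2 - 1) * Suc j - \<delta> (snd i))) (S i)"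
      using sot_sums_embed_compress[OF p[OF i] q[OF ends(2)[OF i]]]
      unfolding p_def q_def Suc_slot[OF A[OF i]] Suc_slot[OF \<delta>(2)[OF ends(2)[OF i]]]
      by (simp only: S_def p_def q_def \<E> N_def)
  qed
  have family: "cuntz_krieger_family ?G S P"
    unfolding cuntz_krieger_family_def
  proof (intro conjI ballI impI)
    fix i assume i: "i \<in> arcs ?G"
    show "partial_isometry (S i)"
      unfolding S_def by (intro partial_isometry_embed_compress p q ends i)
    have "adj (S i) o\<^sub>L S i = P (snd i)"
      unfolding adj_eq[OF adjS[OF i]] unfolding S_def P_def
      by (rule embed_compress_compose[OF p[OF i]])
    then show "adj (S i) o\<^sub>L S i = P (head ?G i)" by (simp add: Pi_graph_def)
  next
    fix v assume v: "v \<in> verts ?G"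
    show "is_projection (P v)"
      unfolding P_def by (rule is_projection_embed_compress[OF q[OF v]])
    assume "out_arcs ?G v \<noteq> {}"
    then have "d v > 0" using fin by (simp add: d_def out_degree_def card_gt_0_iff)
    then have "P v = (\<Sum>i\<in>out_arcs ?G v. basis_embed (\<lambda>j. q v (d v * j + \<kappa> v i)) o\<^sub>L
        basis_compress (\<lambda>j. q v (d v * j + \<kappa> v i)))"
      unfolding P_def by (intro embed_compress_split q v \<kappa>)
    also have "\<dots> = (\<Sum>i\<in>out_arcs ?G v. S i o\<^sub>L adj (S i))"
    proof (rule sum.cong[OF refl])
      fix i assume "i \<in> out_arcs ?G v"
      then have i: "i \<in> arcs ?G" and v: "v = fst i" by (auto simp: Pi_graph_def)
      have "S i o\<^sub>L adj (S i) = basis_embed (p i) o\<^sub>L basis_compress (p i)"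
        unfolding adj_eq[OF adjS[OF i]] unfolding S_def
        by (rule embed_compress_compose[OF q[OF ends(2)[OF i]]])
      then show "basis_embed (\<lambda>j. q v (d v * j + \<kappa> v i)) o\<^sub>L basis_compress (\<lambda>j. q v (d v * j + \<kappa> v i)) =
          S i o\<^sub>L adj (S i)"
        by (simp only: p_eq[OF i] v)
    qed
    finally show "P v = (\<Sum>i\<in>out_arcs ?G v. S i o\<^sub>L adj (S i))" .
  qed
  have "is_adjoint (P v) (P v)" if "v \<in> verts ?G" for v
    unfolding P_def by (intro is_adjoint_embed_compress q that)
  then have cstar: "cstar_subalgebra (graph_cstar_algebra ?G S P)"
    unfolding graph_cstar_algebra_def using adjS by (intro cstar_subalgebra_generated) blast
  have count: "real (card (arcs ?G)) = (real n ^ 3 + real n ^ 2) * (real n - 1) / 2"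
    using card_Pi_arcs(2)[of n] assms by (simp add: Pi_graph_def)
  show ?thesis
    by (rule conjI[OF count], rule exI[of _ "\<lambda>i. \<delta> (snd i)"], rule exI[of _ A],
        rule exI[of _ S], rule exI[of _ P], intro conjI[OF ballI] conjI[OF family] cstar)
      (rule params)
qed

end
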